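(* The operators $Z,\delta_x:\mathrm{DAF}\to\mathrm{DAF}$, $E_0:\mathrm{DAF}\to\mathbb{C}$ and $E_0^*:\mathbb{C}\to\mathrm{DAF}$ satisfy $$\delta_x Z=I,\qquad Z\delta_x=I-E_0^*E_0,$$ where $I$ is the identity operator on $\mathrm{DAF}$.
   Context: Let $\Lambda=\mathbb{Z}+i\mathbb{Z}\subset\mathbb{C}$. A function $f:\Lambda\to\mathbb{C}$ is called discrete analytic if $$\frac{f(z+1+i)-f(z)}{1+i}=\frac{f(z+1)-f(z+i)}{1-i}\quad\text{for all } z\in\Lambda.$$ $\mathrm{DAF}$ denotes the complex vector space of all discrete analytic functions on $\Lambda$. A path in $\Lambda$ from $a$ to $b$ is a finite sequence $\gamma=(z_0,\ldots,z_n)$ of points of $\Lambda$ with $z_0=a$, $z_n=b$ and $|z_k-z_{k-1}|=1$ for $1\le k\le n$. The discrete integral of $f$ over $\gamma$ is $$\int_\gamma f\,\delta z=\sum_{k=1}^n\frac{f(z_{k-1})+f(z_k)}{2}(z_k-z_{k-1}).$$ For $f\in\mathrm{DAF}$ the integral over any closed path is $0$, so $\int_0^z f\,\delta z$ (taken along any path from $0$ to $z$) is well defined, and it is a discrete analytic function of $z$. The operators are defined as follows, for $f\in\mathrm{DAF}$, $z\in\Lambda$, $k\in\mathbb{C}$: $$(\delta_xf)(z)=f(z+1)-f(z),\qquad (Zf)(z)=\frac{f(0)-f(z)}{2}+\int_0^z f\,\delta z,$$ $$E_0f=f(0),\qquad (E_0^*k)(z)=k.$$ (In particular $E_0^*$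 is here just the notation for the operator sending a number to the corresponding constant function.) *)

theory Defs
  imports Complex_Main "HOL-Library.FuncSet"
begin

definition Lattice :: "complex set" ("\<Lambda>") where
  "\<Lambda> = {of_int a + \<i> * of_int b | a b. True}"

(* A function on the lattice is a function on complex numbers that takes the arbitrary
   value undefined off the lattice, so that equality of such functions is equality on
   the lattice. *)
definition DAF :: "(complex \<Rightarrow> complex) set" where
  "DAF = {f \<in> \<Lambda> \<rightarrow>\<^sub>E UNIV. \<forall>z\<in>\<Lambda>.
     (f (z + 1 + \<i>) - f z) / (1 + \<i>) = (f (z + 1) - f (z + \<i>)) / (1 - \<i>)}"

definition lattice_path :: "complex \<Rightarrow> complex \<Rightarrow> complex list \<Rightarrow> bool" where
  "lattice_path a b \<gamma> \<longleftrightarrow> \<gamma> \<noteq> [] \<and> set \<gamma> \<subseteq> \<Lambda> \<and> hd \<gamma> = a \<and> last \<gamma> = b \<and>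
     (\<forall>k\<in>{1..length \<gamma> - 1}. cmod (\<gamma> ! k - \<gamma> ! (k - 1)) = 1)"

definition path_integral :: "complex list \<Rightarrow> (complex \<Rightarrow> complex) \<Rightarrow> complex" where
  "path_integral \<gamma> f =
     (\<Sum>k = 1..length \<gamma> - 1. (f (\<gamma> ! (k - 1)) + f (\<gamma> ! k)) / 2 * (\<gamma> ! k - \<gamma> ! (k - 1)))"

(* The common value of the integrals over all paths from 0 to z; it exists for f in DAF
   and z in the lattice, and is unspecified if the integral depends on the path. *)
definition integral_from_0 :: "(complex \<Rightarrow> complex) \<Rightarrow> complex \<Rightarrow> complex" where
  "integral_from_0 f z = (THE w. \<forall>\<gamma>. lattice_path 0 z \<gamma> \<longrightarrow> path_integral \<gamma> f = w)"

definition delta_x :: "(complex \<Rightarrow> complex) \<Rightarrow> (complex \<Rightarrow> complex)" ("\<delta>\<^sub>x") where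
  "\<delta>\<^sub>x f = (\<lambda>z\<in>\<Lambda>. f (z + 1) - f z)"

definition Z_op :: "(complex \<Rightarrow> complex) \<Rightarrow> (complex \<Rightarrow> complex)" where
  "Z_op f = (\<lambda>z\<in>\<Lambda>. (f 0 - f z) / 2 + integral_from_0 f z)"

definition E0 :: "(complex \<Rightarrow> complex) \<Rightarrow> complex" where
  "E0 f = f 0"

definition E0_star :: "complex \<Rightarrow> (complex \<Rightarrow> complex)" where
  "E0_star k = (\<lambda>z\<in>\<Lambda>. k)"

end

theory Submission imports Defs begin

text \<open>
  Since \<open>(1 + \<i>) / (1 - \<i>) = \<i>\<close>, the defining equation says that the trapezoidal one-form
  \<open>(f z + f w) / 2 * (w - z)\<close> on the edges has integral zero around every unit square. A closed
  one-form on the grid is exact: it has a primitive \<open>F\<close>, obtained by summing along the real axis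
  and then vertically (\<open>closed_grid_form_exact\<close>, \<open>DAF_has_primitive\<close>). Path integrals are
  then differences of values of \<open>F\<close> (\<open>path_integral_primitive\<close>), so that the integral from 0
  can be computed from \<^emph>\<open>any\<close> primitive (\<open>integral_from_0_primitive\<close>).

  With this, both identities are computations with suitable primitives. If \<open>F\<close> is a primitive of
  \<open>f\<close>, then \<open>F (z + 1) - F z = (f z + f (z + 1)) / 2\<close>, and the correction \<open>(f 0 - f z) / 2\<close> in
  the definition of \<open>Z\<close> turns this trapezoidal mean into \<open>f z\<close>; this is the first identity. For
  the second one, the mean \<open>(f z + f (z + 1)) / 2\<close> is an explicit primitive of the difference
  \<open>f (z + 1) - f z\<close>, by analyticity of \<open>f\<close>, and the correction turns it into \<open>f z\<close> up to a
  constant.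
\<close>

section \<open>The lattice and the analyticity equation\<close>

lemma lattice_0 [simp]: "0 \<in> \<Lambda>"
  unfolding Lattice_def by (auto intro!: exI[of _ 0])

lemma lattice_step [simp]:
  assumes "z \<in> \<Lambda>"
  shows "z + 1 \<in> \<Lambda>" "z + \<i> \<in> \<Lambda>" "z - 1 \<in> \<Lambda>" "z - \<i> \<in> \<Lambda>"
proof -
  obtain a b where z: "z = of_int a + \<i> * of_int b"
    using assms unfolding Lattice_def by auto
  have mem: "of_int c + \<i> * of_int d \<in> \<Lambda>" for c d
    unfolding Lattice_def by blast
  show "z + 1 \<in> \<Lambda>" using mem[of "a + 1" b] z by (simp add: algebra_simps)
  show "z + \<i> \<in> \<Lambda>" using mem[of a "b + 1"] z by (simp add: algebra_simps)
  show "z - 1 \<in> \<Lambda>" using mem[of "a - 1" b] z by (simp add: algebra_simps)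
  show "z - \<i> \<in> \<Lambda>" using mem[of a "b - 1"] z by (simp add: algebra_simps)
qed

lemma lattice_unit_step_cases:
  assumes "z \<in> \<Lambda>" "w \<in> \<Lambda>" "cmod (w - z) = 1"
  shows "w = z + 1 \<or> z = w + 1 \<or> w = z + \<i> \<or> z = w + \<i>"
proof -
  obtain a b c d where z: "z = of_int a + \<i> * of_int b" and w: "w = of_int c + \<i> * of_int d"
    using assms(1,2) unfolding Lattice_def by auto
  have "(real_of_int (c - a))\<^sup>2 + (real_of_int (d - b))\<^sup>2 = (cmod (w - z))\<^sup>2"
    by (simp add: z w cmod_power2)
  then have "real_of_int ((c - a)\<^sup>2 + (d - b)\<^sup>2) = real_of_int 1"
    using assms(3) by simp
  then have sq: "(c - a)\<^sup>2 + (d - b)\<^sup>2 = 1"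
    by (simp only: of_int_eq_iff)
  have le: "\<bar>x\<bar> \<le> 1" if "x\<^sup>2 \<le> 1" for x :: int
    using that abs_square_le_1 by blast
  have "\<bar>c - a\<bar> \<le> 1" "\<bar>d - b\<bar> \<le> 1"
    using sq zero_le_power2[of "c - a"] zero_le_power2[of "d - b"] by (intro le, linarith)+
  then have "c - a \<in> {-1, 0, 1}" "d - b \<in> {-1, 0, 1}" by auto
  with sq have "(c - a = 1 \<and> d = b) \<or> (c - a = -1 \<and> d = b) \<or> (c = a \<and> d - b = 1) \<or> (c = a \<and> d - b = -1)"
    by auto
  then have "(c = a + 1 \<and> d = b) \<or> (a = c + 1 \<and> d = b) \<or> (c = a \<and> d = b + 1) \<or> (c = a \<and> b = d + 1)"
    by linarith
  then show ?thesis
    by (auto simp: z w algebra_simps)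
qed

text \<open>The quotient form of the equation is awkward to calculate with; clearing denominators by
  \<open>(1 + \<i>) / (1 - \<i>) = \<i>\<close> makes it linear with coefficients \<open>\<plusminus>1\<close> and \<open>\<plusminus>\<i>\<close>.\<close>

lemma analytic_quotient_iff:
  "(u :: complex) / (1 + \<i>) = v / (1 - \<i>) \<longleftrightarrow> u = \<i> * v"
proof -
  have nz: "1 + \<i> \<noteq> 0" "1 - \<i> \<noteq> 0" by (auto simp: complex_eq_iff)
  have "1 + \<i> = \<i> * (1 - \<i>)" by (simp add: algebra_simps)
  then have "v / (1 - \<i>) = \<i> * v / (1 + \<i>)" using nz by (simp add: divide_simps)
  then show ?thesis using nz by simp
qed

lemma DAF_iff:
  "f \<in> DAF \<longleftrightarrow> f \<in> extensional \<Lambda> \<and>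
     (\<forall>z\<in>\<Lambda>. f (z + 1 + \<i>) - f z = \<i> * (f (z + 1) - f (z + \<i>)))"
  unfolding DAF_def analytic_quotient_iff by (auto simp: PiE_def)

lemma DAF_D:
  "f \<in> DAF \<Longrightarrow> z \<in> \<Lambda> \<Longrightarrow> f (z + 1 + \<i>) = f z + \<i> * (f (z + 1) - f (z + \<i>))"
  by (metis DAF_iff add.commute diff_add_cancel)

section \<open>Primitives of discrete analytic functions\<close>

text \<open>Two-sided partial sums are needed because the lattice extends in both directions.\<close>

lemma ex_antidifference:
  fixes g :: "int \<Rightarrow> 'a::ab_group_add"
  shows "\<exists>G. G 0 = 0 \<and> (\<forall>n. G (n + 1) - G n = g n)"
proof -
  define G where "G n = sum g {0..<n} - sum g {n..<0}" for n
  have "G (n + 1) - G n = g n" for n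
  proof (cases "n \<ge> 0")
    case True
    then have "{0..<n + 1} = insert n {0..<n}" "{n + 1..<0} = {}" "{n..<0} = {}" by auto
    then show ?thesis by (simp add: G_def)
  next
    case False
    then have "{n..<0} = insert n {n + 1..<0}" "{0..<n + 1} = {}" "{0..<n} = {}" by auto
    then show ?thesis by (simp add: G_def)
  qed
  moreover have "G 0 = 0" by (simp add: G_def)
  ultimately show ?thesis by blast
qed

text \<open>Here \<open>h a b\<close> and \<open>v a b\<close> are the values of a one-form on the edges leaving \<open>(a, b)\<close> to the
  right and upwards, and the hypothesis is that its integral around every unit square vanishes.
  The potential is summed along the axis and then vertically, so only its horizontal increments
  need an argument: by closedness, their deviation from \<open>h\<close> does not change from one row to the
  next, and it vanishes in row 0.\<close>

lemma closed_grid_form_exact: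
  fixes h v :: "int \<Rightarrow> int \<Rightarrow> 'a::ab_group_add"
  assumes closed: "\<And>a b. h a b + v (a + 1) b = v a b + h a (b + 1)"
  shows "\<exists>P. (\<forall>a b. P (a + 1) b - P a b = h a b) \<and> (\<forall>a b. P a (b + 1) - P a b = v a b)"
proof -
  obtain R where R: "\<And>a. R (a + 1) - R a = h a 0"
    using ex_antidifference[of "\<lambda>a. h a 0"] by auto
  obtain C where C0: "\<And>a. C a 0 = 0" and C: "\<And>a b. C a (b + 1) - C a b = v a b"
    using ex_antidifference[of "v a" for a] by metis
  define P where "P a b = R a + C a b" for a b
  have vert: "P a (b + 1) = P a b + v a b" for a b
    using C[of a b] by (simp add: P_def algebra_simps)
  have "P (a + 1) b - P a b = h a b" for a b
  proof -
    define e where "e b = P (a + 1) b - P a b - h a b" for b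
    have up: "e (b + 1) = e b" for b
    proof -
      have h: "h a (b + 1) = h a b + v (a + 1) b - v a b"
        using closed[of a b] by (metis add_diff_cancel_left')
      show ?thesis unfolding e_def vert h by (simp add: algebra_simps)
    qed
    have "e b = 0"
    proof (induction b rule: int_induct[of _ 0])
      case base
      show ?case using R[of a] by (simp add: e_def P_def C0)
    next
      case (step1 b)
      then show ?case by (simp add: up)
    next
      case (step2 b)
      then show ?case using up[of "b - 1"] by simp
    qed
    then show ?thesis by (simp add: e_def)
  qed
  then show ?thesis using vert by (intro exI[of _ P]) simp
qed

definition trapezoidal_primitive :: "(complex \<Rightarrow> complex) \<Rightarrow> (complex \<Rightarrow> complex) \<Rightarrow> bool" where
  "trapezoidal_primitive F f \<longleftrightarrow> (\<forall>z\<in>\<Lambda>.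
     F (z + 1) = F z + (f z + f (z + 1)) / 2 \<and>
     F (z + \<i>) = F z + \<i> * (f z + f (z + \<i>)) / 2)"

lemma DAF_has_primitive:
  assumes "f \<in> DAF"
  obtains F where "trapezoidal_primitive F f"
proof -
  define g where "g a b = f (of_int a + \<i> * of_int b)" for a b
  define h where "h a b = (g a b + g (a + 1) b) / 2" for a b
  define v where "v a b = \<i> * (g a b + g a (b + 1)) / 2" for a b
  have g: "g (a + 1) (b + 1) = g a b + \<i> * (g (a + 1) b - g a (b + 1))" for a b
  proof -
    have "of_int a + \<i> * of_int b \<in> \<Lambda>" unfolding Lattice_def by blast
    from DAF_D[OF assms this] show ?thesis
      by (simp add: g_def algebra_simps)
  qed
  have "h a b + v (a + 1) b = v a b + h a (b + 1)" for a b
    unfolding h_def v_def g by (simp add: field_simps)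
  from closed_grid_form_exact[of h v, OF this] obtain P
    where Ph: "\<And>a b. P (a + 1) b - P a b = h a b" and Pv: "\<And>a b. P a (b + 1) - P a b = v a b"
    by auto
  define F where "F z = P \<lfloor>Re z\<rfloor> \<lfloor>Im z\<rfloor>" for z
  have F: "F (of_int a + \<i> * of_int b) = P a b" for a b
    by (simp add: F_def)
  have "trapezoidal_primitive F f"
    unfolding trapezoidal_primitive_def
  proof
    fix z assume "z \<in> \<Lambda>"
    then obtain a b where z: "z = of_int a + \<i> * of_int b"
      unfolding Lattice_def by auto
    have right: "z + 1 = of_int (a + 1) + \<i> * of_int b"
      and up: "z + \<i> = of_int a + \<i> * of_int (b + 1)"
      by (simp_all add: z algebra_simps)
    have gz: "g a b = f z" "g (a + 1) b = f (z + 1)" "g a (b + 1) = f (z + \<i>)"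
      unfolding g_def right up unfolding z by simp_all
    have Fz: "F z = P a b" "F (z + 1) = P (a + 1) b" "F (z + \<i>) = P a (b + 1)"
      unfolding right up F unfolding z F by simp_all
    have "F (z + 1) = F z + (f z + f (z + 1)) / 2"
      using Ph[of a b] unfolding h_def gz Fz by (metis add.commute diff_add_cancel)
    moreover have "F (z + \<i>) = F z + \<i> * (f z + f (z + \<i>)) / 2"
      using Pv[of a b] unfolding v_def gz Fz by (metis add.commute diff_add_cancel)
    ultimately show "F (z + 1) = F z + (f z + f (z + 1)) / 2 \<and>
        F (z + \<i>) = F z + \<i> * (f z + f (z + \<i>)) / 2" by blast
  qed
  then show thesis by (rule that)
qed

section \<open>Path integrals\<close>

lemma path_integral_primitive:
  assumes F: "trapezoidal_primitive F f" and path: "lattice_path a b \<gamma>"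
  shows "path_integral \<gamma> f = F b - F a"
proof -
  have ne: "\<gamma> \<noteq> []" and sub: "set \<gamma> \<subseteq> \<Lambda>" and ends: "hd \<gamma> = a" "last \<gamma> = b"
    and unit: "\<And>k. k \<in> {1..length \<gamma> - 1} \<Longrightarrow> cmod (\<gamma> ! k - \<gamma> ! (k - 1)) = 1"
    using path by (auto simp: lattice_path_def)
  have edge: "(f z + f w) / 2 * (w - z) = F w - F z"
    if "z \<in> \<Lambda>" "w \<in> \<Lambda>" "cmod (w - z) = 1" for z w
  proof -
    have inc: "F (u + 1) = F u + (f u + f (u + 1)) / 2"
      "F (u + \<i>) = F u + \<i> * (f u + f (u + \<i>)) / 2" if "u \<in> \<Lambda>" for u
      using F that unfolding trapezoidal_primitive_def by blast+
    show ?thesis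
      using lattice_unit_step_cases[OF that]
    proof (elim disjE)
      assume w: "w = z + 1"
      show ?thesis unfolding w inc(1)[OF that(1)] by (simp add: field_simps)
    next
      assume z: "z = w + 1"
      show ?thesis unfolding z inc(1)[OF that(2)] by (simp add: field_simps)
    next
      assume w: "w = z + \<i>"
      show ?thesis unfolding w inc(2)[OF that(1)] by (simp add: field_simps)
    next
      assume z: "z = w + \<i>"
      show ?thesis unfolding z inc(2)[OF that(2)] by (simp add: field_simps)
    qed
  qed
  have "path_integral \<gamma> f = (\<Sum>k = 1..length \<gamma> - 1. F (\<gamma> ! k) - F (\<gamma> ! (k - 1)))"
    unfolding path_integral_def
  proof (rule sum.cong)
    fix k assume k: "k \<in> {1..length \<gamma> - 1}"
    then have "k < length \<gamma>" "k - 1 < length \<gamma>" by auto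
    then have "\<gamma> ! k \<in> \<Lambda>" "\<gamma> ! (k - 1) \<in> \<Lambda>" using sub nth_mem by blast+
    then show "(f (\<gamma> ! (k - 1)) + f (\<gamma> ! k)) / 2 * (\<gamma> ! k - \<gamma> ! (k - 1))
        = F (\<gamma> ! k) - F (\<gamma> ! (k - 1))"
      using edge unit[OF k] by blast
  qed simp
  also have "\<dots> = F (\<gamma> ! (length \<gamma> - 1)) - F (\<gamma> ! 0)"
    using sum_telescope''[of 0 "length \<gamma> - 1" "\<lambda>k. F (\<gamma> ! k)"]
    by (simp add: atLeastSucAtMost_greaterThanAtMost)
  also have "\<dots> = F b - F a"
    using ne ends by (simp add: hd_conv_nth last_conv_nth)
  finally show ?thesis .
qed

lemma lattice_path_snoc:
  assumes "lattice_path a z \<gamma>" "w \<in> \<Lambda>" "cmod (w - z) = 1"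
  shows "lattice_path a w (\<gamma> @ [w])"
  unfolding lattice_path_def
proof (intro conjI ballI)
  fix k assume k: "k \<in> {1..length (\<gamma> @ [w]) - 1}"
  show "cmod ((\<gamma> @ [w]) ! k - (\<gamma> @ [w]) ! (k - 1)) = 1"
  proof (cases "k = length \<gamma>")
    case True
    have "\<gamma> \<noteq> []" "\<gamma> ! (length \<gamma> - 1) = z"
      using assms(1) by (auto simp: lattice_path_def last_conv_nth)
    then show ?thesis
      using True assms(3) by (simp add: nth_append)
  next
    case False
    with k have "k \<in> {1..length \<gamma> - 1}" "k < length \<gamma>" "k - 1 < length \<gamma>" by auto
    then show ?thesis using assms(1) by (simp add: lattice_path_def nth_append)
  qed
qed (use assms in \<open>auto simp: lattice_path_def\<close>)

text \<open>Without a path from 0 to \<open>z\<close>, every number would be a common value of all the integrals, and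
  the description defining the integral from 0 would not determine one.\<close>

lemma lattice_path_exists:
  assumes "z \<in> \<Lambda>"
  shows "\<exists>\<gamma>. lattice_path 0 z \<gamma>"
proof -
  define reach where "reach z \<longleftrightarrow> z \<in> \<Lambda> \<and> (\<exists>\<gamma>. lattice_path 0 z \<gamma>)" for z
  have step: "reach w" if "reach z" "w \<in> \<Lambda>" "cmod (w - z) = 1" for z w
    using that lattice_path_snoc unfolding reach_def by blast
  have "lattice_path 0 0 [0]" by (simp add: lattice_path_def)
  then have origin: "reach 0" unfolding reach_def by auto
  have inL: "reach z \<Longrightarrow> z \<in> \<Lambda>" for z by (simp add: reach_def)
  have moves: "reach (z + 1)" "reach (z - 1)" "reach (z + \<i>)" "reach (z - \<i>)"
    if "reach z" for z
    using step[OF that] inL[OF that] by simp_all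
  have row: "reach (of_int a)" for a :: int
  proof (induction a rule: int_induct[of _ 0])
    case base
    show ?case using origin by simp
  next
    case (step1 a)
    then show ?case using moves(1)[of "of_int a"] by simp
  next
    case (step2 a)
    then show ?case using moves(2)[of "of_int a"] by simp
  qed
  have "reach (of_int a + \<i> * of_int b)" for a b :: int
  proof (induction b rule: int_induct[of _ 0])
    case base
    show ?case using row by simp
  next
    case (step1 b)
    then show ?case using moves(3)[of "of_int a + \<i> * of_int b"] by (simp add: algebra_simps)
  next
    case (step2 b)
    then show ?case using moves(4)[of "of_int a + \<i> * of_int b"] by (simp add: algebra_simps)
  qed
  then show ?thesis using assms unfolding Lattice_def reach_def by auto
qed

lemma integral_from_0_primitive:
  assumes F: "trapezoidal_primitive F f" and z: "z \<in> \<Lambda>"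
  shows "integral_from_0 f z = F z - F 0"
  unfolding integral_from_0_def
proof (rule the_equality)
  show "\<forall>\<gamma>. lattice_path 0 z \<gamma> \<longrightarrow> path_integral \<gamma> f = F z - F 0"
    using path_integral_primitive[OF F] by blast
  fix w assume "\<forall>\<gamma>. lattice_path 0 z \<gamma> \<longrightarrow> path_integral \<gamma> f = w"
  then show "w = F z - F 0"
    using lattice_path_exists[OF z] path_integral_primitive[OF F] by metis
qed

lemma Z_op_primitive:
  assumes "trapezoidal_primitive F f" "z \<in> \<Lambda>"
  shows "Z_op f z = (f 0 - f z) / 2 + (F z - F 0)"
  using assms by (simp add: Z_op_def integral_from_0_primitive)

section \<open>The operators\<close>

lemma E0_star_in_DAF: "E0_star k \<in> DAF"
  by (simp add: DAF_iff E0_star_def)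

lemma delta_x_apply: "z \<in> \<Lambda> \<Longrightarrow> \<delta>\<^sub>x f z = f (z + 1) - f z"
  by (simp add: delta_x_def)

lemma delta_x_in_DAF:
  assumes f: "f \<in> DAF"
  shows "\<delta>\<^sub>x f \<in> DAF"
proof -
  have "\<delta>\<^sub>x f (z + 1 + \<i>) - \<delta>\<^sub>x f z = \<i> * (\<delta>\<^sub>x f (z + 1) - \<delta>\<^sub>x f (z + \<i>))"
    if z: "z \<in> \<Lambda>" for z
  proof -
    have comm: "z + 1 + \<i> + 1 = z + 1 + 1 + \<i>" "z + \<i> + 1 = z + 1 + \<i>"
      by (simp_all add: algebra_simps)
    show ?thesis
      using z by (simp only: delta_x_apply lattice_step comm DAF_D[OF f])
        (simp add: algebra_simps)
  qed
  then show ?thesis by (simp add: DAF_iff delta_x_def)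
qed

text \<open>Up to a constant, \<open>Z f\<close> is \<open>F - f / 2\<close> for a primitive \<open>F\<close> of \<open>f\<close>. As the equation is linear
  and holds for constants, it is enough that it holds for \<open>F\<close>: writing the diagonal increments of
  \<open>F\<close> through edge increments turns it into a multiple of the equation for \<open>f\<close>.\<close>

lemma Z_op_in_DAF:
  assumes f: "f \<in> DAF"
  shows "Z_op f \<in> DAF"
proof -
  obtain F where F: "trapezoidal_primitive F f" using DAF_has_primitive[OF f] .
  have "Z_op f (z + 1 + \<i>) - Z_op f z = \<i> * (Z_op f (z + 1) - Z_op f (z + \<i>))"
    if z: "z \<in> \<Lambda>" for z
  proof -
    have inc: "F (z + 1) = F z + (f z + f (z + 1)) / 2"
      "F (z + \<i>) = F z + \<i> * (f z + f (z + \<i>)) / 2"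
      "F (z + 1 + \<i>) = F (z + 1) + \<i> * (f (z + 1) + f (z + 1 + \<i>)) / 2"
      using F z lattice_step(1)[OF z] unfolding trapezoidal_primitive_def by blast+
    show ?thesis
      using z by (simp only: Z_op_primitive[OF F] lattice_step inc DAF_D[OF f z])
        (simp add: field_simps)
  qed
  then show ?thesis by (simp add: DAF_iff Z_op_def)
qed

lemma delta_x_Z_op:
  assumes f: "f \<in> DAF"
  shows "\<delta>\<^sub>x (Z_op f) = f"
proof (rule extensionalityI[of _ \<Lambda>])
  obtain F where F: "trapezoidal_primitive F f" using DAF_has_primitive[OF f] .
  fix z assume z: "z \<in> \<Lambda>"
  have "F (z + 1) = F z + (f z + f (z + 1)) / 2"
    using F z by (simp add: trapezoidal_primitive_def)
  then have "Z_op f (z + 1) - Z_op f z = f z"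
    unfolding Z_op_primitive[OF F z] Z_op_primitive[OF F lattice_step(1)[OF z]]
    by (simp add: field_simps)
  then show "\<delta>\<^sub>x (Z_op f) z = f z"
    using z by (simp add: delta_x_def)
qed (use f in \<open>auto simp: DAF_iff delta_x_def\<close>)

text \<open>The horizontal condition holds for every function \<open>f\<close>: both sides are
  \<open>(f (z + 1) + f (z + 2)) / 2\<close>. The vertical one involves only the values at the four corners of
  one square, and is a multiple of the equation for \<open>f\<close> on this square.\<close>

lemma delta_x_primitive:
  assumes f: "f \<in> DAF"
  shows "trapezoidal_primitive (\<lambda>z. (f z + f (z + 1)) / 2) (\<delta>\<^sub>x f)"
  unfolding trapezoidal_primitive_def
proof (intro ballI conjI)
  fix z assume z: "z \<in> \<Lambda>"
  show "(f (z + 1) + f (z + 1 + 1)) / 2 = (f z + f (z + 1)) / 2 + (\<delta>\<^sub>x f z + \<delta>\<^sub>x f (z + 1)) / 2"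
    using z by (simp only: delta_x_apply lattice_step) (simp add: field_simps)
  have comm: "z + \<i> + 1 = z + 1 + \<i>" by (simp add: algebra_simps)
  show "(f (z + \<i>) + f (z + \<i> + 1)) / 2
      = (f z + f (z + 1)) / 2 + \<i> * (\<delta>\<^sub>x f z + \<delta>\<^sub>x f (z + \<i>)) / 2"
    using z by (simp only: delta_x_apply lattice_step comm DAF_D[OF f z]) (simp add: field_simps)
qed

lemma Z_op_delta_x:
  assumes f: "f \<in> DAF"
  shows "Z_op (\<delta>\<^sub>x f) = (\<lambda>z\<in>\<Lambda>. f z - E0_star (E0 f) z)"
proof (rule extensionalityI[of _ \<Lambda>])
  fix z assume z: "z \<in> \<Lambda>"
  have "Z_op (\<delta>\<^sub>x f) z = f z - f 0"
    unfolding Z_op_primitive[OF delta_x_primitive[OF f] z]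
    using z by (simp add: delta_x_def field_simps)
  then show "Z_op (\<delta>\<^sub>x f) z = (\<lambda>z\<in>\<Lambda>. f z - E0_star (E0 f) z) z"
    using z by (simp add: E0_star_def E0_def)
qed (auto simp: Z_op_def)

theorem theorem3p1:
  shows "Z_op \<in> DAF \<rightarrow> DAF \<and> \<delta>\<^sub>x \<in> DAF \<rightarrow> DAF \<and> E0 \<in> DAF \<rightarrow> UNIV \<and> E0_star \<in> UNIV \<rightarrow> DAF
    \<and> (\<forall>f\<in>DAF. \<delta>\<^sub>x (Z_op f) = f)
    \<and> (\<forall>f\<in>DAF. Z_op (\<delta>\<^sub>x f) = (\<lambda>z\<in>\<Lambda>. f z - E0_star (E0 f) z))"
  using Z_op_in_DAF delta_x_in_DAF E0_star_in_DAF delta_x_Z_op Z_op_delta_x by simp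

end
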